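(* For any finite multiset $\mathcal M$ of elements of $\mathcal B$ and any piecewise decreasing and connected dashed patterns $p_1,p_2,\ldots,p_m$, the $m$-tuples of statistics $(p_1,p_2,\ldots,p_m)$ and $(\mathrm R\,p_1,\mathrm R\,p_2,\ldots,\mathrm R\,p_m)$ have the same (joint) distribution over $\mathcal W(\mathcal M)$; that is, for all integers $k_1,\ldots,k_m\geq 0$, the number of words in $\mathcal W(\mathcal M)$ having exactly $k_i$ occurrences of $p_i$ for every $i$ equals the number of words in $\mathcal W(\mathcal M)$ having exactly $k_i$ occurrences of $\mathrm R\,p_i$ for every $i$.
   Context: $\mathbb P$ is the set of positive integers and $\mathbb P^*$ the free monoid of finite words over $\mathbb P$. $\mathcal B$ is the set of nonempty finite strictly decreasing sequences of positive integers. The descending runs of a word are its maximal contiguous strictly decreasing subsequences. For a finite multiset $\mathcal M=\{D_1,\ldots,D_r\}$ of elements of $\mathcal B$, $\mathcal W(\mathcal M)$ is the set of words in $\mathbb P^*$ whose multiset of descending runs is $\mathcal M$. A dashed pattern $p$ of length $m$ is a word $p_1\cdots p_m$ whose set of letters is exactly $\{1,\dots,r\}$ for some $r\geq1$, in which two adjacent letters may or may not be separated by a dash; it is written $p=\tau^{(1)}-\cdots-\tau^{(\ell)}$, where the $\tau^{(i)}$ are nonempty dash-free words. An occurrence of $p$ in a word $w=w_1\cdots w_n\in\mathbb P^*$ is a choice of positions $1\le i_1<\dots<i_m\le n$ such that $w_{i_s}>w_{i_t}$ if and only if $p_s>p_t$ for all $s,t$, and $i_{s+1}=i_s+1$ whenever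 $p_s$ and $p_{s+1}$ are not separated by a dash. The statistic $(p_1,\ldots,p_m)$ (for patterns $p_1,\dots,p_m$) sends $w$ to the vector of numbers of occurrences of the patterns in $w$. For $p=\tau^{(1)}-\cdots-\tau^{(\ell)}$, $\mathrm R\,p=\tau^{(\ell)}-\tau^{(\ell-1)}-\cdots-\tau^{(1)}$. For nonempty words $w,w'\in\mathbb P^*$, $w$ is below $w'$ if every letter of $w$ is smaller than every letter of $w'$; $w\ll w'$ means $w=w'$ or $w$ is below $w'$. The words $w,w'$ are comparable if $w\ll w'$ or $w'\ll w$, and incomparable otherwise. A dashed pattern $\tau^{(1)}-\cdots-\tau^{(\ell)}$ is connected if for each $i=1,\ldots,\ell-1$ the words $\tau^{(i)}$ and $\tau^{(i+1)}$ are incomparable or equal; it is piecewise decreasing if each $\tau^{(i)}$ is strictly decreasing. *)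

theory Defs
  imports Main "HOL-Library.Multiset"
begin

definition words :: "nat list set" where
  "words = {w. \<forall>x\<in>set w. 0 < x}"

abbreviation strictly_decreasing :: "nat list \<Rightarrow> bool" where
  "strictly_decreasing \<equiv> sorted_wrt (>)"

definition decreasing_seqs :: "nat list set" where
  "decreasing_seqs = {D. D \<noteq> [] \<and> D \<in> words \<and> strictly_decreasing D}"

(* The contiguous subsequence of w at the (0-based) positions i, ..., j - 1. *)
definition factor :: "nat list \<Rightarrow> nat \<Rightarrow> nat \<Rightarrow> nat list" where
  "factor w i j = take (j - i) (drop i w)"

definition decreasing_interval :: "nat list \<Rightarrow> nat \<Rightarrow> nat \<Rightarrow> bool" where
  "decreasing_interval w i j \<longleftrightarrow>
     i < j \<and> j \<le> length w \<and> strictly_decreasing (factor w i j)"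

(* Runs are first located by their positions, so that equal runs occurring at
   different places of w are counted with multiplicity. *)
definition run_intervals :: "nat list \<Rightarrow> (nat \<times> nat) set" where
  "run_intervals w = {(i, j). decreasing_interval w i j \<and>
     (\<forall>i' j'. decreasing_interval w i' j' \<and> i' \<le> i \<and> j \<le> j' \<longrightarrow> i' = i \<and> j' = j)}"

definition descending_runs :: "nat list \<Rightarrow> nat list multiset" where
  "descending_runs w = image_mset (\<lambda>(i, j). factor w i j) (mset_set (run_intervals w))"

definition words_with_runs :: "nat list multiset \<Rightarrow> nat list set" where
  "words_with_runs M = {w \<in> words. descending_runs w = M}"

(* A dashed pattern is the list of its dash-free blocks; its underlying word
   is the concatenation of the blocks. *)
type_synonym dashed = "nat list list"

definition dashed_pattern :: "dashed \<Rightarrow> bool" where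
  "dashed_pattern p \<longleftrightarrow> (\<forall>t\<in>set p. t \<noteq> []) \<and> (\<exists>r\<ge>1. set (concat p) = {1..r})"

(* There is a dash between the letters of concat p at the 0-based positions
   s and s + 1, i.e. some proper initial list of blocks has s + 1 letters. *)
definition dash_after :: "dashed \<Rightarrow> nat \<Rightarrow> bool" where
  "dash_after p s \<longleftrightarrow> (\<exists>k<length p. Suc s = length (concat (take k p)))"

(* An occurrence is given by its increasing list of 0-based positions. *)
definition occurrences :: "dashed \<Rightarrow> nat list \<Rightarrow> nat list set" where
  "occurrences p w = {is.
     length is = length (concat p) \<and> sorted_wrt (<) is \<and> (\<forall>i\<in>set is. i < length w) \<and>
     (\<forall>s<length is. \<forall>t<length is. w ! (is ! s) > w ! (is ! t) \<longleftrightarrow> concat p ! s > concat p ! t) \<and>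
     (\<forall>s. Suc s < length is \<and> \<not> dash_after p s \<longrightarrow> is ! Suc s = Suc (is ! s))}"

definition occ :: "dashed \<Rightarrow> nat list \<Rightarrow> nat" where
  "occ p w = card (occurrences p w)"

definition pattern_statistic :: "dashed list \<Rightarrow> nat list \<Rightarrow> nat list" where
  "pattern_statistic ps w = map (\<lambda>p. occ p w) ps"

definition R :: "dashed \<Rightarrow> dashed" where
  "R p = rev p"

(* This relation and the next two are only meant for nonempty words. *)
definition below :: "nat list \<Rightarrow> nat list \<Rightarrow> bool" where
  "below w w' \<longleftrightarrow> (\<forall>x\<in>set w. \<forall>y\<in>set w'. x < y)"

definition below_eq :: "nat list \<Rightarrow> nat list \<Rightarrow> bool" (infix \<open>\<lless>\<close> 50) where
  "w \<lless> w' \<longleftrightarrow> w = w' \<or> below w w'"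

definition comparable_words :: "nat list \<Rightarrow> nat list \<Rightarrow> bool" where
  "comparable_words w w' \<longleftrightarrow> w \<lless> w' \<or> w' \<lless> w"

definition connected_pattern :: "dashed \<Rightarrow> bool" where
  "connected_pattern p \<longleftrightarrow>
     (\<forall>i. Suc i < length p \<longrightarrow> \<not> comparable_words (p ! i) (p ! Suc i) \<or> p ! i = p ! Suc i)"

definition piecewise_decreasing :: "dashed \<Rightarrow> bool" where
  "piecewise_decreasing p \<longleftrightarrow> (\<forall>t\<in>set p. strictly_decreasing t)"

end

theory Submission imports Defs "HOL-Library.Sublist" begin

text \<open>
  A word is the same thing as the list of its descending runs, a list of decreasing sequences in which
  no run is followed by a run below it. If distinct comparable runs are allowed to commute, every
  commutation class of lists of decreasing sequences contains exactly one such list, so the words with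
  given runs correspond to commutation classes. For a piecewise decreasing connected pattern, each
  block of an occurrence lies in a single run and consecutive blocks lie in runs that do not commute;
  hence the number of occurrences depends only on the commutation class. Reversing the order of the
  runs is well defined on commutation classes and exchanges the occurrences of \<open>p\<close> and \<open>R p\<close>.
\<close>

subsection \<open>Normal forms under commutation\<close>

fun insert_comm :: "('a \<Rightarrow> 'a \<Rightarrow> bool) \<Rightarrow> 'a \<Rightarrow> 'a list \<Rightarrow> 'a list" where
  "insert_comm r x [] = [x]"
| "insert_comm r x (y # ys) = (if r y x then y # insert_comm r x ys else x # y # ys)"

text \<open>Insertion sort for a relation that need not be total. Elements move only past elements
  with which they commute, so the result need not be sorted; it serves as the canonical
  representative of a commutation class.\<close>

definition normal_form :: "('a \<Rightarrow> 'a \<Rightarrow> bool) \<Rightarrow> 'a list \<Rightarrow> 'a list" where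
  "normal_form r xs = foldr (insert_comm r) xs []"

lemma normal_form_simps [simp]:
  "normal_form r [] = []"
  "normal_form r (x # xs) = insert_comm r x (normal_form r xs)"
  by (simp_all add: normal_form_def)

definition normal :: "('a \<Rightarrow> 'a \<Rightarrow> bool) \<Rightarrow> 'a list \<Rightarrow> bool" where
  "normal r = successively (\<lambda>x y. \<not> r y x)"

text \<open>Invariance under the swaps that generate commutation. The equation is symmetric, so
  swaps in both directions are covered.\<close>

definition comm_invariant :: "('a \<Rightarrow> 'a \<Rightarrow> bool) \<Rightarrow> ('a list \<Rightarrow> 'b) \<Rightarrow> bool" where
  "comm_invariant r f \<longleftrightarrow> (\<forall>as x y bs. r x y \<longrightarrow> f (as @ x # y # bs) = f (as @ y # x # bs))"

text \<open>By transitivity every \<open>z\<close> that \<open>x\<close> passes is also passed by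
  \<open>y\<close>, so \<open>x\<close> stops no later than \<open>y\<close>. If both stop at the
  same place, \<open>r x y\<close> and asymmetry put \<open>x\<close> first in either order of
  insertion.\<close>

lemma insert_comm_commute:
  assumes "transp r" "asymp r" "r x y"
  shows "insert_comm r x (insert_comm r y zs) = insert_comm r y (insert_comm r x zs)"
  using assms by (induction zs) (auto dest: transpD asympD)

lemma comm_invariant_normal_form:
  assumes "transp r" "asymp r"
  shows "comm_invariant r (normal_form r)"
proof -
  have "normal_form r (as @ x # y # bs) = normal_form r (as @ y # x # bs)" if "r x y" for as x y bs
    by (induction as) (simp_all add: insert_comm_commute[OF assms that])
  then show ?thesis by (auto simp: comm_invariant_def)
qed

text \<open>Insertion moves \<open>x\<close> past one \<open>y\<close> with \<open>r y x\<close> at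
  a time, and each such move is an admissible swap. The prefix \<open>as\<close> is arbitrary in the
  induction because it absorbs the elements already passed.\<close>

lemma comm_invariant_insert_comm:
  assumes "comm_invariant r f"
  shows "f (as @ insert_comm r x ys) = f (as @ x # ys)"
proof (induction ys arbitrary: as)
  case (Cons y ys)
  show ?case
  proof (cases "r y x")
    case True
    then have "f (as @ y # x # ys) = f (as @ x # y # ys)"
      using assms by (auto simp: comm_invariant_def)
    with True Cons.IH[of "as @ [y]"] show ?thesis by simp
  qed simp
qed simp

text \<open>A list and its normal form are joined by admissible swaps; testing with arbitrary
  invariant \<open>f\<close> expresses this without introducing the equivalence relation.\<close>

lemma comm_invariant_apply_normal_form:
  assumes "comm_invariant r f"
  shows "f (normal_form r xs) = f xs"
proof -
  have "f (as @ normal_form r xs) = f (as @ xs)" for as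
  proof (induction xs arbitrary: as)
    case (Cons x xs)
    show ?case using Cons.IH[of "as @ [x]"] comm_invariant_insert_comm[OF assms, of as x] by simp
  qed simp
  from this[of "[]"] show ?thesis by simp
qed

lemma comm_invariant_rev:
  assumes "comm_invariant r f"
  shows "comm_invariant r (\<lambda>xs. f (rev xs))"
  unfolding comm_invariant_def
proof (intro allI impI)
  fix as x y bs assume "r x y"
  then show "f (rev (as @ x # y # bs)) = f (rev (as @ y # x # bs))"
    using assms[unfolded comm_invariant_def, rule_format, of x y "rev bs" "rev as"] by simp
qed

lemma comm_invariant_mset: "comm_invariant r mset"
  by (simp add: comm_invariant_def)

text \<open>An inserted \<open>x\<close> stops before a \<open>y\<close> with
  \<open>\<not> r y x\<close>, which is what the new pair must satisfy. A passed \<open>y\<close>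
  satisfies \<open>r y x\<close>, and asymmetry then excludes \<open>r x y\<close>.\<close>

lemma normal_normal_form:
  assumes "asymp r"
  shows "normal r (normal_form r xs)"
proof -
  have hd: "insert_comm r x ys = x # ys \<or> (\<exists>y ys'. ys = y # ys' \<and> insert_comm r x ys = y # insert_comm r x ys')"
    for x ys by (cases ys) auto
  have "normal r (insert_comm r x ys)" if "normal r ys" for x ys
    using that
  proof (induction ys)
    case (Cons y ys)
    have "normal r ys" using Cons.prems by (cases ys) (auto simp: normal_def)
    with Cons assms show ?case
      by (cases ys) (auto simp: normal_def dest: asympD split: if_splits)
  qed (simp add: normal_def)
  then show ?thesis by (induction xs) (auto simp: normal_def)
qed

lemma normal_form_normal:
  "normal r xs \<Longrightarrow> normal_form r xs = xs"
  unfolding normal_def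
proof (induction xs)
  case (Cons x xs)
  then show ?case by (cases xs) auto
qed simp

text \<open>Reversal followed by normalisation is itself invariant, so the inner normal form may be
  dropped. The two reversals then cancel, and a normal list is its own normal form.\<close>

lemma normal_form_rev_involution:
  assumes "transp r" "asymp r" "normal r xs"
  shows "normal_form r (rev (normal_form r (rev xs))) = xs"
  using comm_invariant_apply_normal_form
      [OF comm_invariant_rev[OF comm_invariant_normal_form[OF assms(1,2)]], of "rev xs"]
    normal_form_normal[OF assms(3)] by simp

subsection \<open>Words and their descending runs\<close>

text \<open>Unlike \<^const>\<open>below\<close>, this is a strict order on all words, including the empty one.\<close>
definition strict_below :: "nat list \<Rightarrow> nat list \<Rightarrow> bool" where
  "strict_below D E \<longleftrightarrow> D \<noteq> [] \<and> E \<noteq> [] \<and> below D E"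

lemma transp_strict_below: "transp strict_below"
proof (rule transpI)
  fix A B C assume *: "strict_below A B" "strict_below B C"
  then obtain b where "b \<in> set B" by (cases B) (auto simp: strict_below_def)
  with * show "strict_below A C" by (force simp: strict_below_def below_def)
qed

lemma asymp_strict_below: "asymp strict_below"
proof (rule asympI)
  fix A B assume *: "strict_below A B"
  then obtain a b where "a \<in> set A" "b \<in> set B"
    by (cases A; cases B) (auto simp: strict_below_def)
  with * show "\<not> strict_below B A" by (force simp: strict_below_def below_def)
qed

lemma strictly_decreasing_append_iff:
  "strictly_decreasing (D @ y # w) \<longleftrightarrow> strictly_decreasing D \<and> strictly_decreasing (y # w) \<and> (D \<noteq> [] \<longrightarrow> y < last D)"
proof (cases D rule: rev_cases)
  case (snoc D' x)
  show ?thesis unfolding snoc sorted_wrt_append by force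
qed simp

text \<open>A decreasing word has its largest letter first and its smallest last, so the two
  boundary letters decide. Descents between neighbouring runs thus become comparabilities of
  runs.\<close>

lemma strict_below_iff:
  assumes "D \<noteq> []" "E \<noteq> []" "strictly_decreasing D" "strictly_decreasing E"
  shows "strict_below E D \<longleftrightarrow> hd E < last D"
proof
  assume "strict_below E D"
  then show "hd E < last D" using assms by (auto simp: strict_below_def below_def)
next
  assume *: "hd E < last D"
  obtain e E' where E: "E = e # E'" using assms by (cases E) auto
  have "strictly_decreasing (D @ E)"
    using assms * by (simp add: E strictly_decreasing_append_iff)
  then show "strict_below E D"
    using assms by (auto simp: strict_below_def below_def sorted_wrt_append)
qed

fun runs :: "nat list \<Rightarrow> nat list list" where
  "runs [] = []"
| "runs (x # w) = (case runs w of [] \<Rightarrow> [[x]] | D # Ds \<Rightarrow> if hd D < x then (x # D) # Ds else [x] # D # Ds)"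

text \<open>These are exactly the lists \<open>runs w\<close>. Normality expresses that the runs are
  maximal: no run can be merged with the next one.\<close>

definition run_list :: "nat list list \<Rightarrow> bool" where
  "run_list Ds \<longleftrightarrow> (\<forall>D\<in>set Ds. D \<noteq> [] \<and> strictly_decreasing D) \<and> normal strict_below Ds"

lemma run_list_Nil [simp]: "run_list []"
  by (simp add: run_list_def normal_def)

text \<open>By \<open>strict_below_iff\<close>, normality at the front compares
  \<open>last D\<close> with the first letter of the next run, which is
  \<open>hd (concat Ds)\<close> since runs are nonempty.\<close>

lemma run_list_Cons:
  "run_list (D # Ds) \<longleftrightarrow> D \<noteq> [] \<and> strictly_decreasing D \<and> run_list Ds
     \<and> (Ds \<noteq> [] \<longrightarrow> last D \<le> hd (concat Ds))"
proof (cases Ds)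
  case (Cons E Es)
  show ?thesis
  proof (cases "D \<noteq> [] \<and> E \<noteq> [] \<and> strictly_decreasing D \<and> strictly_decreasing E")
    case True
    then have "strict_below E D \<longleftrightarrow> hd E < last D" by (intro strict_below_iff) simp_all
    with True show ?thesis by (auto simp: run_list_def normal_def Cons)
  qed (auto simp: run_list_def normal_def Cons)
qed (simp add: run_list_def normal_def)

lemma concat_runs [simp]: "concat (runs w) = w"
  by (induction w) (auto split: list.splits)

lemma run_list_runs: "run_list (runs w)"
proof (induction w)
  case (Cons x w)
  show ?case
  proof (cases "runs w")
    case (Cons D Ds)
    then obtain d D' where D: "D = d # D'"
      using \<open>run_list (runs w)\<close> by (cases D) (auto simp: run_list_Cons)
    show ?thesis
      using \<open>run_list (runs w)\<close> by (auto simp: Cons D run_list_Cons)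
  qed (simp add: run_list_Cons)
qed simp

lemma runs_concat: "run_list Ds \<Longrightarrow> runs (concat Ds) = Ds"
proof (induction Ds)
  case (Cons D Ds)
  from Cons.prems have rl: "run_list Ds" and D: "D \<noteq> []" "strictly_decreasing D"
    and sep: "Ds \<noteq> [] \<longrightarrow> last D \<le> hd (concat Ds)"
    by (simp_all add: run_list_Cons)
  have IH: "runs (concat Ds) = Ds" using rl by (rule Cons.IH)
  have ne: "\<forall>E\<in>set Ds. E \<noteq> []" using rl by (simp add: run_list_def)
  \<comment> \<open>The letters of \<open>D\<close> are prepended from right to left: the last one
    opens a new run (by \<open>sep\<close> if \<open>Ds\<close> is nonempty), and each earlier one
    joins it because \<open>D\<close> decreases.\<close>
  have "runs (D @ concat Ds) = D # Ds"
    using D sep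
  proof (induction D)
    case (Cons x D)
    note px = Cons.prems(3)
    show ?case
    proof (cases D)
      case Nil
      show ?thesis
      proof (cases Ds)
        case (Cons E Es)
        then have "hd (concat Ds) = hd E" using ne by (simp add: hd_append)
        moreover have "x \<le> hd (concat Ds)" using px Cons Nil by simp
        ultimately show ?thesis using Nil Cons IH by simp
      qed (simp add: Nil)
    next
      case (Cons y D')
      then show ?thesis using Cons.IH Cons.prems by simp
    qed
  qed simp
  then show ?case by simp
qed simp

section \<open>Maximal decreasing intervals of a concatenation\<close>

lemma factor_append:
  "factor (D @ w) i j = (if j \<le> length D then factor D i j
     else if length D \<le> i then factor w (i - length D) (j - length D)
     else drop i D @ take (j - length D) w)"
  by (auto simp: factor_def)

lemma strictly_decreasing_factor: "strictly_decreasing D \<Longrightarrow> strictly_decreasing (factor D i j)"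
  by (simp add: factor_def sorted_wrt_drop sorted_wrt_take)

text \<open>An interval across the boundary would contain the adjacent letters \<open>last D\<close>
  and \<open>hd w\<close>, which do not descend. Hence every decreasing interval lies on one
  side.\<close>

lemma decreasing_interval_append:
  assumes "strictly_decreasing D" "w \<noteq> [] \<Longrightarrow> last D \<le> hd w"
  shows "decreasing_interval (D @ w) i j \<longleftrightarrow> (i < j \<and> j \<le> length D) \<or>
    (length D \<le> i \<and> decreasing_interval w (i - length D) (j - length D))"
proof -
  consider "j \<le> length D" | "length D \<le> i" "length D < j" | "i < length D" "length D < j" by linarith
  then show ?thesis
  proof cases
    case 3
    have "\<not> strictly_decreasing (drop i D @ take (j - length D) w)" if jw: "j \<le> length D + length w"
    proof -
      obtain y w' where w: "w = y # w'" using 3 jw by (cases w) auto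
      obtain n where n: "j - length D = Suc n" using 3 by (cases "j - length D") auto
      show ?thesis using 3 assms(2) by (simp add: w n strictly_decreasing_append_iff)
    qed
    then show ?thesis using 3 by (auto simp: decreasing_interval_def factor_append)
  qed (auto simp: decreasing_interval_def factor_append strictly_decreasing_factor assms)
qed

text \<open>Since decreasing intervals do not cross the boundary, maximality can be tested on each
  side separately: all of \<open>D\<close> is maximal, and the maximal intervals of \<open>w\<close>
  are shifted by \<open>length D\<close>.\<close>

lemma run_intervals_append:
  assumes "D \<noteq> []" "strictly_decreasing D" "w \<noteq> [] \<Longrightarrow> last D \<le> hd w"
  shows "run_intervals (D @ w) =
    insert (0, length D) (map_prod ((+) (length D)) ((+) (length D)) ` run_intervals w)"
    (is "?L = ?R")
proof -
  note dec = decreasing_interval_append[OF assms(2,3)]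
  let ?n = "length D"
  have pos: "0 < ?n" using assms by simp
  have nz: "i < j" if "decreasing_interval w i j" for i j
    using that by (simp add: decreasing_interval_def)
  have a: "(i, j) \<in> ?L \<longleftrightarrow> (i, j) = (0, ?n)" if "i < ?n" for i j
  proof
    assume ij: "(i, j) \<in> ?L"
    then have "j \<le> ?n" using that by (auto simp: run_intervals_def dec)
    moreover have "decreasing_interval (D @ w) 0 ?n" using pos by (simp add: dec)
    ultimately show "(i, j) = (0, ?n)" using ij that by (fastforce simp: run_intervals_def)
  next
    assume "(i, j) = (0, ?n)"
    then show "(i, j) \<in> ?L" using pos by (auto simp: run_intervals_def dec dest: nz)
  qed
  have b: "(?n + i, ?n + j) \<in> ?L \<longleftrightarrow> (i, j) \<in> run_intervals w" for i j
  proof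
    assume "(?n + i, ?n + j) \<in> ?L"
    then have 1: "decreasing_interval w i j"
      and 2: "\<And>i' j'. decreasing_interval (D @ w) i' j' \<Longrightarrow> i' \<le> ?n + i \<Longrightarrow> ?n + j \<le> j' \<Longrightarrow> i' = ?n + i \<and> j' = ?n + j"
      by (auto simp: run_intervals_def dec)
    have "i' = i \<and> j' = j" if "decreasing_interval w i' j'" "i' \<le> i" "j \<le> j'" for i' j'
      using 2[of "?n + i'" "?n + j'"] that by (simp add: dec)
    with 1 show "(i, j) \<in> run_intervals w" by (auto simp: run_intervals_def)
  next
    assume ij: "(i, j) \<in> run_intervals w"
    then have 1: "decreasing_interval w i j"
      and 2: "\<And>i' j'. decreasing_interval w i' j' \<Longrightarrow> i' \<le> i \<Longrightarrow> j \<le> j' \<Longrightarrow> i' = i \<and> j' = j"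
      by (auto simp: run_intervals_def)
    have "i' = ?n + i \<and> j' = ?n + j"
      if *: "decreasing_interval (D @ w) i' j'" "i' \<le> ?n + i" "?n + j \<le> j'" for i' j'
    proof -
      \<comment> \<open>This makes \<open>j' > length D\<close>, so the larger interval cannot lie
        inside \<open>D\<close> and must come from \<open>w\<close>.\<close>
      have "i < j" using 1 by (rule nz)
      then have "?n \<le> i'" "decreasing_interval w (i' - ?n) (j' - ?n)" using * by (auto simp: dec)
      moreover from this have "i' - ?n = i \<and> j' - ?n = j" by (intro 2) (use * in linarith)+
      ultimately show ?thesis using \<open>i < j\<close> by linarith
    qed
    with 1 show "(?n + i, ?n + j) \<in> ?L" by (auto simp: run_intervals_def dec)
  qed
  have "ij \<in> ?L \<longleftrightarrow> ij \<in> ?R" for ij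
  proof -
    obtain i j where ij: "ij = (i, j)" by fastforce
    show ?thesis
    proof (cases "i < ?n")
      case True
      then show ?thesis using a by (auto simp: ij)
    next
      case False
      show ?thesis
      proof (cases "?n \<le> j")
        case True
        then have "(i, j) \<in> ?L \<longleftrightarrow> (i - ?n, j - ?n) \<in> run_intervals w"
          using False b[of "i - ?n" "j - ?n"] by simp
        also have "\<dots> \<longleftrightarrow> ij \<in> ?R"
          using False True pos by (force simp: ij image_iff)
        finally show ?thesis by (simp add: ij)
      next
        case j: False
        \<comment> \<open>Here \<open>j < length D \<le> i\<close>: the left side needs
          \<open>i < j\<close>, the right side a second component of at least
          \<open>length D\<close>.\<close>
        then show ?thesis using False
          by (auto simp: ij run_intervals_def decreasing_interval_def)
      qed
    qed
  qed
  then show ?thesis by blast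
qed

lemma finite_run_intervals: "finite (run_intervals w)"
  by (rule finite_subset[of _ "{..length w} \<times> {..length w}"])
    (auto simp: run_intervals_def decreasing_interval_def)

lemma descending_runs_concat: "run_list Ds \<Longrightarrow> descending_runs (concat Ds) = mset Ds"
proof (induction Ds)
  case Nil
  have "run_intervals [] = {}" by (auto simp: run_intervals_def decreasing_interval_def)
  then show ?case by (simp add: descending_runs_def)
next
  case (Cons D Ds)
  let ?n = "length D" and ?w = "concat Ds"
  let ?f = "map_prod ((+) ?n) ((+) ?n)"
  from Cons.prems have D: "D \<noteq> []" "strictly_decreasing D" "?w \<noteq> [] \<Longrightarrow> last D \<le> hd ?w"
    by (auto simp: run_list_Cons)
  have f: "factor (D @ ?w) (?n + i) (?n + j) = factor ?w i j" for i j
    by (simp add: factor_def)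
  \<comment> \<open>Injectivity of the shift preserves the multiplicities of equal runs at different
    places.\<close>
  have inj: "inj_on ?f (run_intervals ?w)" by (auto intro: inj_onI)
  have ri: "run_intervals (D @ ?w) = insert (0, ?n) (?f ` run_intervals ?w)"
    by (rule run_intervals_append) (use D in auto)
  \<comment> \<open>Shifted intervals start at \<open>length D\<close> or later, so the interval of
    \<open>D\<close> is new and adds one copy of \<open>D\<close>.\<close>
  have "(0, ?n) \<notin> ?f ` run_intervals ?w" using D(1) by auto
  then have "descending_runs (D @ ?w) =
      add_mset D (image_mset (\<lambda>(i, j). factor (D @ ?w) i j) (mset_set (?f ` run_intervals ?w)))"
    unfolding descending_runs_def ri
    by (simp add: finite_run_intervals) (simp add: factor_def)
  also have "\<dots> = add_mset D (descending_runs ?w)"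
    by (simp add: image_mset_mset_set[OF inj, symmetric] image_mset.compositionality
        descending_runs_def f comp_def case_prod_unfold)
  finally show ?case using Cons by (simp add: run_list_Cons)
qed

text \<open>The inverse is \<open>runs\<close>. The hypothesis on \<open>M\<close> makes all letters
  positive, so that the concatenation lies in \<open>words\<close>.\<close>

lemma bij_betw_concat_words_with_runs:
  assumes "\<forall>D\<in>#M. D \<in> decreasing_seqs"
  shows "bij_betw concat {Ds. run_list Ds \<and> mset Ds = M} (words_with_runs M)"
proof (rule bij_betw_byWitness[where f' = runs])
  have "concat Ds \<in> words_with_runs M" if "run_list Ds" "mset Ds = M" for Ds
  proof -
    have "set Ds \<subseteq> words" using assms that(2) by (auto simp: decreasing_seqs_def)
    then have "concat Ds \<in> words" by (auto simp: words_def)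
    then show ?thesis using descending_runs_concat[OF that(1)] that(2) by (simp add: words_with_runs_def)
  qed
  then show "concat ` {Ds. run_list Ds \<and> mset Ds = M} \<subseteq> words_with_runs M"
    by blast
  show "runs ` words_with_runs M \<subseteq> {Ds. run_list Ds \<and> mset Ds = M}"
    using descending_runs_concat[OF run_list_runs]
    by (auto simp: words_with_runs_def run_list_runs)
  show "\<forall>Ds\<in>{Ds. run_list Ds \<and> mset Ds = M}. runs (concat Ds) = Ds"
    by (simp add: runs_concat)
qed simp

subsection \<open>Placements of blocks in a word\<close>

text \<open>The numbers in the first list are block lengths, those in the last one the starting positions.\<close>
fun valid_starts :: "nat list \<Rightarrow> nat \<Rightarrow> nat \<Rightarrow> nat list \<Rightarrow> bool" where
  "valid_starts [] k n as \<longleftrightarrow> as = []"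
| "valid_starts (l # ls) k n [] \<longleftrightarrow> False"
| "valid_starts (l # ls) k n (a # as) \<longleftrightarrow> k \<le> a \<and> a + l \<le> n \<and> valid_starts ls (a + l) n as"

definition blocks_at :: "'a list \<Rightarrow> nat list \<Rightarrow> nat list \<Rightarrow> 'a list list" where
  "blocks_at w ls as = map2 (\<lambda>l a. take l (drop a w)) ls as"

text \<open>An arbitrary predicate \<open>P\<close> takes the place of pattern matching, so that an
  induction can fix the first block \<open>F\<close> and pass to
  \<open>\<lambda>Fs. P (F # Fs)\<close>. The bound \<open>k\<close> is the least start
  allowed.\<close>

definition placements :: "('a list list \<Rightarrow> bool) \<Rightarrow> nat list \<Rightarrow> nat \<Rightarrow> 'a list \<Rightarrow> nat list set" where
  "placements P ls k w = {as. valid_starts ls k (length w) as \<and> P (blocks_at w ls as)}"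

lemma finite_placements: "finite (placements P ls k w)"
proof (rule finite_subset)
  have "set as \<subseteq> {..n} \<and> length as = length ls" if "valid_starts ls k n as" for n as
    using that by (induction ls k n as rule: valid_starts.induct) auto
  then show "placements P ls k w \<subseteq> {as. set as \<subseteq> {..length w} \<and> length as = length ls}"
    by (auto simp: placements_def)
qed (rule finite_lists_length_eq, simp)

lemma card_placements_Nil [simp]: "card (placements P [] k w) = of_bool (P [])"
proof -
  have "placements P [] k w = (if P [] then {[]} else {})"
    by (auto simp: placements_def blocks_at_def)
  then show ?thesis by simp
qed

lemma placements_False: "(\<And>Fs. \<not> P Fs) \<Longrightarrow> placements P ls k w = {}"
  by (simp add: placements_def)

lemma placements_beyond:
  assumes "length w \<le> k" "0 < l"
  shows "placements P (l # ls) k w = {}"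
proof -
  have "\<not> valid_starts (l # ls) k (length w) as" for as
    using assms by (cases as) auto
  then show ?thesis by (simp add: placements_def)
qed

text \<open>The first block starts either at \<open>k\<close>, where it is known and moves into the
  predicate, or later.\<close>

lemma card_placements_Cons:
  "card (placements P (l # ls) k w) =
     (if k + l \<le> length w then card (placements (\<lambda>Fs. P (take l (drop k w) # Fs)) ls (k + l) w) else 0)
     + card (placements P (l # ls) (Suc k) w)"
proof -
  let ?A = "placements (\<lambda>Fs. P (take l (drop k w) # Fs)) ls (k + l) w"
  let ?B = "placements P (l # ls) (Suc k) w"
  let ?A' = "if k + l \<le> length w then Cons k ` ?A else {}"
  have "as \<in> placements P (l # ls) k w \<longleftrightarrow> as \<in> ?A' \<union> ?B" for as
    by (cases as) (auto simp: placements_def blocks_at_def le_less Suc_le_eq)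
  then have "placements P (l # ls) k w = ?A' \<union> ?B" by blast
  moreover have "?A' \<inter> ?B = {}" by (auto simp: placements_def)
  ultimately have "card (placements P (l # ls) k w) = card ?A' + card ?B"
    by (simp add: card_Un_disjoint finite_placements)
  then show ?thesis by (simp add: card_image)
qed

text \<open>What is needed of the blocks: a decreasing block lies inside one run, and two
  consecutive blocks cannot lie in the same run, since the second would then be below the
  first.\<close>

definition respects_runs :: "(nat list list \<Rightarrow> bool) \<Rightarrow> bool" where
  "respects_runs P \<longleftrightarrow>
     (\<forall>Fs. P Fs \<longrightarrow> (\<forall>F\<in>set Fs. strictly_decreasing F) \<and> normal strict_below Fs)"

lemma respects_runs_Cons:
  assumes "respects_runs P"
  shows "respects_runs (\<lambda>Fs. P (F # Fs))"
  unfolding respects_runs_def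
proof (intro allI impI)
  fix Fs assume "P (F # Fs)"
  then have "(\<forall>G\<in>set (F # Fs). strictly_decreasing G) \<and> normal strict_below (F # Fs)"
    using assms unfolding respects_runs_def by blast
  then show "(\<forall>G\<in>set Fs. strictly_decreasing G) \<and> normal strict_below Fs"
    by (cases Fs) (auto simp: normal_def)
qed

section \<open>Placing blocks run by run\<close>

lemma card_placements_skip:
  assumes "drop k w = U @ V" "\<forall>l\<in>set ls. 0 < l"
    and "\<And>y F Fs. y \<in> set U \<Longrightarrow> \<not> P ((y # F) # Fs)"
  shows "card (placements P ls k w) = card (placements P ls (k + length U) w)"
  using assms(1,3)
proof (induction U arbitrary: k)
  case (Cons x U)
  have k: "drop (Suc k) w = U @ V"
    using Cons.prems(1) by (metis append_Cons drop_Suc list.sel(3) tl_drop)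
  have IH: "card (placements P ls (Suc k) w) = card (placements P ls (k + length (x # U)) w)"
    using Cons.IH[OF k] Cons.prems(2) by simp
  show ?case
  proof (cases ls)
    case ls: (Cons l ls')
    \<comment> \<open>Blocks have positive length, so a block placed at \<open>k\<close> begins with
      \<open>x\<close>, which the hypothesis on \<open>P\<close> excludes.\<close>
    then obtain n where "l = Suc n" using assms(2) by (cases l) auto
    then have "\<not> P (take l (drop k w) # Fs)" for Fs
      using Cons.prems by simp
    then have "placements (\<lambda>Fs. P (take l (drop k w) # Fs)) ls' (k + l) w = {}"
      by (rule placements_False)
    then have "card (placements P ls k w) = card (placements P ls (Suc k) w)"
      unfolding ls by (subst card_placements_Cons) simp
    with IH show ?thesis by simp
  qed simp
qed simp

text \<open>Factors are taken as words, without positions: a decreasing \<open>D\<close> has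
  distinct letters, so a nonempty factor occurs in it only once.\<close>

definition factors_of_length :: "nat \<Rightarrow> 'a list \<Rightarrow> 'a list set" where
  "factors_of_length l D = {F. sublist F D \<and> length F = l}"

lemma finite_factors_of_length [simp]: "finite (factors_of_length l D)"
  by (rule finite_subset[OF _ finite_set[of "sublists D"]])
    (auto simp: factors_of_length_def)

lemma factors_of_length_Cons:
  "factors_of_length l (x # D) =
     (if l \<le> Suc (length D) then insert (take l (x # D)) (factors_of_length l D) else {})"
proof -
  have "prefix F (x # D) \<and> length F = l \<longleftrightarrow> l \<le> Suc (length D) \<and> F = take l (x # D)" for F
  proof
    assume *: "prefix F (x # D) \<and> length F = l"
    then show "l \<le> Suc (length D) \<and> F = take l (x # D)"
      using prefix_length_le[of F "x # D"] by (auto simp: prefix_def)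
  qed (simp add: take_is_prefix)
  then show ?thesis
    by (auto simp: factors_of_length_def sublist_Cons_right dest: sublist_length_le)
qed

text \<open>
  A second block starting in the rest of the run of the first block would be below the first one, so
  the remaining blocks may as well be placed after the whole run.
\<close>
lemma card_placements_run:
  assumes "drop k w = D @ V" "0 < l" "\<forall>l\<in>set ls. 0 < l" "respects_runs P"
    "strictly_decreasing D" "D \<noteq> [] \<Longrightarrow> V \<noteq> [] \<Longrightarrow> last D \<le> hd V"
  shows "card (placements P (l # ls) k w) =
    (\<Sum>F\<in>factors_of_length l D. card (placements (\<lambda>Fs. P (F # Fs)) ls (k + length D) w))
    + card (placements P (l # ls) (k + length D) w)"
  using assms(1,5,6)
proof (induction D arbitrary: k)
  case Nil
  then have "factors_of_length l [] = ({} :: nat list set)"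
    using assms(2) by (auto simp: factors_of_length_def)
  then show ?case by simp
next
  case (Cons x D)
  let ?F = "take l (x # D)"
  have k: "drop (Suc k) w = D @ V"
    using Cons.prems(1) by (metis append_Cons drop_Suc list.sel(3) tl_drop)
  have len: "length w = k + Suc (length D) + length V"
    using arg_cong[OF Cons.prems(1), of length] by simp
  have IH: "card (placements P (l # ls) (Suc k) w) =
    (\<Sum>F\<in>factors_of_length l D. card (placements (\<lambda>Fs. P (F # Fs)) ls (k + length (x # D)) w))
    + card (placements P (l # ls) (k + length (x # D)) w)"
  proof -
    have "D \<noteq> [] \<Longrightarrow> V \<noteq> [] \<Longrightarrow> last D \<le> hd V" using Cons.prems(3) by simp
    then show ?thesis using Cons.IH[OF k] Cons.prems(2) by simp
  qed
  show ?case
  proof (cases "l \<le> Suc (length D)")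
    case True
    have "drop (k + l) w = drop l (drop k w)" by (simp add: add.commute)
    then have dr: "drop (k + l) w = drop l (x # D) @ V"
      unfolding Cons.prems(1) using True by (simp only: drop_append) simp
    \<comment> \<open>A letter \<open>y\<close> of the rest of the run is smaller than all of
      \<open>?F\<close>. A decreasing block starting with \<open>y\<close> is then strictly below
      \<open>?F\<close>, contrary to normality.\<close>
    have "\<not> P (?F # (y # G) # Fs)" if y: "y \<in> set (drop l (x # D))" for y G Fs
    proof
      assume "P (?F # (y # G) # Fs)"
      then have G: "strictly_decreasing (y # G)" and nb: "\<not> strict_below (y # G) ?F"
        using assms(4) by (force simp: respects_runs_def normal_def)+
      have "strictly_decreasing (?F @ drop l (x # D))"
        using Cons.prems(2) by (simp only: append_take_drop_id)
      then have "y < z" if "z \<in> set ?F" for z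
        using that y unfolding sorted_wrt_append by blast
      then have "strict_below (y # G) ?F"
        using G assms(2) by (fastforce simp: strict_below_def below_def)
      with nb show False ..
    qed
    then have "card (placements (\<lambda>Fs. P (?F # Fs)) ls (k + l) w) =
        card (placements (\<lambda>Fs. P (?F # Fs)) ls (k + l + length (drop l (x # D))) w)"
      by (intro card_placements_skip[OF dr assms(3)]) blast
    then have "card (placements (\<lambda>Fs. P (?F # Fs)) ls (k + l) w) =
        card (placements (\<lambda>Fs. P (?F # Fs)) ls (k + length (x # D)) w)"
      using True by simp
    moreover have "take l (drop k w) = ?F"
      unfolding Cons.prems(1) using True by (simp only: take_append) simp
    \<comment> \<open>The letters of the run are distinct, so \<open>x\<close> occurs in
      \<open>?F\<close> but not in \<open>D\<close>; thus \<open>?F\<close> is a new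
      summand.\<close>
    moreover have "?F \<notin> factors_of_length l D"
    proof
      assume "?F \<in> factors_of_length l D"
      then have "set ?F \<subseteq> set D"
        by (auto simp: factors_of_length_def dest: set_mono_sublist)
      moreover have "x \<in> set ?F" using assms(2) by (cases l) auto
      ultimately show False using Cons.prems(2) by auto
    qed
    ultimately show ?thesis
      using True len by (subst card_placements_Cons) (simp add: factors_of_length_Cons IH)
  next
    case False
    have "factors_of_length l D = {}"
      using False by (auto simp: factors_of_length_def dest: sublist_length_le)
    \<comment> \<open>Such a block would contain all of \<open>x # D\<close> and the first letter of
      \<open>V\<close>, and there is no descent between them.\<close>
    moreover have "\<not> P (take l (drop k w) # Fs)" if kl: "k + l \<le> length w" for Fs
    proof
      assume "P (take l (drop k w) # Fs)"
      then have dec: "strictly_decreasing (take l ((x # D) @ V))"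
        using assms(4) Cons.prems(1) by (simp add: respects_runs_def)
      obtain y V' where V: "V = y # V'" using False kl len by (cases V) auto
      obtain n where n: "l - length (x # D) = Suc n"
        using False by (cases "l - length (x # D)") auto
      have "take l ((x # D) @ V) = (x # D) @ y # take n V'"
        using False n by (simp add: V take_append del: append_Cons)
      then have "y < last (x # D)"
        using dec by (simp only: strictly_decreasing_append_iff) simp
      then show False using Cons.prems(3) V by simp
    qed
    then have "k + l \<le> length w \<Longrightarrow> placements (\<lambda>Fs. P (take l (drop k w) # Fs)) ls (k + l) w = {}"
      by (intro placements_False)
    ultimately show ?thesis
      using False by (subst card_placements_Cons) (simp add: factors_of_length_Cons IH)
  qed
qed

text \<open>Each listed run hosts exactly one block, chosen as a contiguous factor. The positions in
  the word have disappeared; only the order of the runs remains.\<close>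

definition selections :: "('a list list \<Rightarrow> bool) \<Rightarrow> nat list \<Rightarrow> 'a list list \<Rightarrow> 'a list list set" where
  "selections P ls Es = {Fs. list_all2 sublist Fs Es \<and> map length Fs = ls \<and> P Fs}"

lemma finite_selections: "finite (selections P ls Es)"
proof (rule finite_subset)
  have "set Fs \<subseteq> (\<Union>E\<in>set Es. set (sublists E)) \<and> length Fs = length Es"
    if "list_all2 sublist Fs Es" for Fs
    using that by (induction rule: list_all2_induct) auto
  then show "selections P ls Es \<subseteq>
      {Fs. set Fs \<subseteq> (\<Union>E\<in>set Es. set (sublists E)) \<and> length Fs = length Es}"
    by (auto simp: selections_def)
qed (rule finite_lists_length_eq, simp)

lemma selections_Nil:
  "card (selections P [] []) = of_bool (P [])"
  "selections P [] (E # Es) = {}"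
  "selections P (l # ls) [] = {}"
proof -
  have "selections P [] [] = (if P [] then {[]} else {})" by (auto simp: selections_def)
  then show "card (selections P [] []) = of_bool (P [])" by simp
qed (auto simp: selections_def)

lemma card_selections_Cons:
  "card (selections P (l # ls) (E # Es)) =
     (\<Sum>F\<in>factors_of_length l E. card (selections (\<lambda>Fs. P (F # Fs)) ls Es))"
proof -
  have "selections P (l # ls) (E # Es) =
      (\<Union>F\<in>factors_of_length l E. Cons F ` selections (\<lambda>Fs. P (F # Fs)) ls Es)"
    by (auto simp: selections_def factors_of_length_def list_all2_Cons2)
  also have "card \<dots> = (\<Sum>F\<in>factors_of_length l E. card (Cons F ` selections (\<lambda>Fs. P (F # Fs)) ls Es))"
    by (intro card_UN_disjoint) (auto simp: finite_selections)
  finally show ?thesis by (simp add: card_image)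
qed

lemma sum_list_sum_swap:
  fixes f :: "'a \<Rightarrow> 'b \<Rightarrow> 'c::comm_monoid_add"
  shows "(\<Sum>x\<leftarrow>xs. \<Sum>y\<in>A. f x y) = (\<Sum>y\<in>A. \<Sum>x\<leftarrow>xs. f x y)"
  by (induction xs) (simp_all add: sum.distrib)

text \<open>Blocks lie in distinct runs, so placements can be sorted by the subsequence of runs that
  host them. Summing over the list \<open>subseqs Ds\<close> counts equal runs at different places
  separately. In the induction, the first run either hosts the first block or none.\<close>

lemma card_placements_concat:
  assumes "drop k w = concat Ds" "run_list Ds" "\<forall>l\<in>set ls. 0 < l" "respects_runs P"
  shows "card (placements P ls k w) = (\<Sum>Es\<leftarrow>subseqs Ds. card (selections P ls Es))"
  using assms
proof (induction Ds arbitrary: k ls P)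
  case Nil
  then show ?case
    by (cases ls) (simp_all add: selections_Nil placements_beyond)
next
  case (Cons D Ds)
  have Ds: "run_list Ds" "strictly_decreasing D" "concat Ds \<noteq> [] \<Longrightarrow> last D \<le> hd (concat Ds)"
    using Cons.prems(2) by (auto simp: run_list_Cons)
  have "drop (k + length D) w = drop (length D) (drop k w)" by (simp add: add.commute)
  then have k: "drop (k + length D) w = concat Ds" by (simp add: Cons.prems(1))
  have IH: "card (placements Q ls' (k + length D) w) = (\<Sum>Es\<leftarrow>subseqs Ds. card (selections Q ls' Es))"
    if "\<forall>l\<in>set ls'. 0 < l" "respects_runs Q" for Q ls'
    by (rule Cons.IH[OF k Ds(1) that])
  \<comment> \<open>A subsequence either uses this copy of \<open>D\<close> as its first entry or
    omits it.\<close>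
  have sum: "(\<Sum>Es\<leftarrow>subseqs (D # Ds). card (selections P ls Es)) =
      (\<Sum>Es\<leftarrow>subseqs Ds. card (selections P ls (D # Es))) + (\<Sum>Es\<leftarrow>subseqs Ds. card (selections P ls Es))"
    by (simp add: Let_def comp_def)
  show ?case
  proof (cases ls)
    case Nil
    have "(\<Sum>Es\<leftarrow>subseqs Ds. card (selections P ls (D # Es))) = 0"
      by (simp add: Nil selections_Nil)
    moreover have "card (placements P ls k w) = card (placements P ls (k + length D) w)"
      by (simp add: Nil)
    ultimately show ?thesis unfolding sum using IH[OF Cons.prems(3,4)] by simp
  next
    case ls: (Cons l ls')
    have "(\<Sum>Es\<leftarrow>subseqs Ds. card (selections P ls (D # Es))) =
        (\<Sum>F\<in>factors_of_length l D. \<Sum>Es\<leftarrow>subseqs Ds. card (selections (\<lambda>Fs. P (F # Fs)) ls' Es))"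
      unfolding ls card_selections_Cons by (rule sum_list_sum_swap)
    also have "\<dots> = (\<Sum>F\<in>factors_of_length l D. card (placements (\<lambda>Fs. P (F # Fs)) ls' (k + length D) w))"
      using Cons.prems(3,4) ls by (intro sum.cong refl IH[symmetric] respects_runs_Cons) auto
    finally have "(\<Sum>Es\<leftarrow>subseqs Ds. card (selections P ls (D # Es))) + card (placements P ls (k + length D) w)
        = card (placements P ls k w)"
      using Cons.prems Ds unfolding ls
      by (subst card_placements_run[where D = D and V = "concat Ds"]) auto
    then show ?thesis unfolding sum using IH[OF Cons.prems(3,4)] by simp
  qed
qed

subsection \<open>Occurrences of linked patterns\<close>

text \<open>The order condition concerns only the set of pairs of a letter and its pattern letter,
  which makes it insensitive to a simultaneous reversal of the blocks.\<close>

definition matches :: "dashed \<Rightarrow> nat list list \<Rightarrow> bool" where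
  "matches p Fs \<longleftrightarrow> map length Fs = map length p \<and>
     (\<forall>(x, a)\<in>set (zip (concat Fs) (concat p)). \<forall>(y, b)\<in>set (zip (concat Fs) (concat p)). y < x \<longleftrightarrow> b < a)"

lemma set_zip_concat:
  assumes "map length xss = map length yss"
  shows "set (zip (concat xss) (concat yss)) = (\<Union>(xs, ys)\<in>set (zip xss yss). set (zip xs ys))"
proof -
  have "length xss = length yss" using assms by (rule map_eq_imp_length_eq)
  then show ?thesis using assms
    by (induction xss yss rule: list_induct2) auto
qed

lemma matches_rev: "matches (rev p) (rev Fs) \<longleftrightarrow> matches p Fs"
proof (cases "map length Fs = map length p")
  case True
  then have len: "length Fs = length p" by (rule map_eq_imp_length_eq)
  have True': "map length (rev Fs) = map length (rev p)" by (simp add: rev_map[symmetric] True)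
  show ?thesis
    unfolding matches_def set_zip_concat[OF True] set_zip_concat[OF True']
    by (simp only: zip_rev[OF len] set_rev True True' simp_thms)
qed (simp add: matches_def rev_map[symmetric])

lemma matches_nth:
  assumes "matches p Fs" "i < length p" "j < length p" "s < length (p ! i)" "t < length (p ! j)"
  shows "Fs ! j ! t < Fs ! i ! s \<longleftrightarrow> p ! j ! t < p ! i ! s"
proof -
  have *: "map length Fs = map length p" using assms(1) unfolding matches_def by blast
  then have len: "length Fs = length p" by (rule map_eq_imp_length_eq)
  have mem: "(Fs ! i ! s, p ! i ! s) \<in> set (zip (concat Fs) (concat p))"
    if "i < length p" "s < length (p ! i)" for i s
  proof -
    have "length (Fs ! i) = length (p ! i)"
      using arg_cong[OF *, of "\<lambda>xs. xs ! i"] that len by simp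
    then have "(Fs ! i ! s, p ! i ! s) \<in> set (zip (Fs ! i) (p ! i))"
      using that by (auto simp: set_zip)
    moreover have "(Fs ! i, p ! i) \<in> set (zip Fs p)"
      using that len by (auto simp: set_zip)
    ultimately show ?thesis unfolding set_zip_concat[OF *] by blast
  qed
  show ?thesis using assms mem[OF assms(2,4)] mem[OF assms(3,5)] unfolding matches_def by blast
qed

lemma matches_length_nth:
  assumes "matches p Fs" "i < length p"
  shows "length (Fs ! i) = length (p ! i)"
proof -
  have *: "map length Fs = map length p" using assms(1) unfolding matches_def by blast
  then have "length Fs = length p" by (rule map_eq_imp_length_eq)
  then show ?thesis using arg_cong[OF *, of "\<lambda>xs. xs ! i"] assms(2) by simp
qed

text \<open>Being strictly below depends only on comparisons of letters and on nonemptiness, and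
  both are shared by a pattern and its matches.\<close>

lemma matches_strict_below:
  assumes "matches p Fs" "i < length p" "j < length p"
  shows "strict_below (Fs ! i) (Fs ! j) \<longleftrightarrow> strict_below (p ! i) (p ! j)"
proof -
  note len = matches_length_nth[OF assms(1,2)] matches_length_nth[OF assms(1,3)]
  have "below (Fs ! i) (Fs ! j) \<longleftrightarrow> below (p ! i) (p ! j)"
    using matches_nth[OF assms(1,3,2)] unfolding below_def all_set_conv_all_nth len by blast
  then show ?thesis
    using len unfolding strict_below_def length_0_conv[symmetric] by metis
qed

text \<open>The form of connectedness that the counting uses: neighbouring blocks are not strictly
  comparable. The condition is symmetric, hence stable under \<open>R\<close>.\<close>

definition linked_pattern :: "dashed \<Rightarrow> bool" where
  "linked_pattern p \<longleftrightarrow> (\<forall>t\<in>set p. t \<noteq> [] \<and> strictly_decreasing t)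
     \<and> successively (\<lambda>s t. \<not> strict_below s t \<and> \<not> strict_below t s) p"

lemma linked_pattern_R: "linked_pattern (R p) \<longleftrightarrow> linked_pattern p"
  by (auto simp: linked_pattern_def R_def conj_commute)

text \<open>Unequal neighbours are incomparable by connectedness; for equal neighbours the strict
  order is irreflexive.\<close>

lemma linked_patternI:
  assumes "dashed_pattern p" "piecewise_decreasing p" "connected_pattern p"
  shows "linked_pattern p"
proof -
  have "\<not> strict_below (p ! i) (p ! Suc i) \<and> \<not> strict_below (p ! Suc i) (p ! i)" if i: "Suc i < length p" for i
  proof -
    have "\<not> comparable_words (p ! i) (p ! Suc i) \<or> p ! i = p ! Suc i"
      using assms(3) i by (simp add: connected_pattern_def)
    moreover have "\<not> strict_below t t" for t using asympD[OF asymp_strict_below, of t t] by blast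
    ultimately show ?thesis
    proof (elim disjE)
      assume "\<not> comparable_words (p ! i) (p ! Suc i)"
      then show ?thesis by (simp add: comparable_words_def below_eq_def strict_below_def)
    qed simp
  qed
  then show ?thesis
    using assms by (simp add: linked_pattern_def successively_conv_nth dashed_pattern_def piecewise_decreasing_def)
qed

lemma respects_runs_matches:
  assumes "linked_pattern p"
  shows "respects_runs (matches p)"
  unfolding respects_runs_def
proof (intro allI impI conjI)
  fix Fs assume m: "matches p Fs"
  then have len: "length Fs = length p"
    unfolding matches_def by (intro map_eq_imp_length_eq) blast
  show "\<forall>F\<in>set Fs. strictly_decreasing F"
    unfolding all_set_conv_all_nth len
  proof (intro allI impI)
    fix i assume i: "i < length p"
    then have "strictly_decreasing (p ! i)" using assms by (simp add: linked_pattern_def)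
    then show "strictly_decreasing (Fs ! i)"
      using matches_nth[OF m i i] matches_length_nth[OF m i]
      unfolding sorted_wrt_iff_nth_less by auto
  qed
  show "normal strict_below Fs"
    unfolding normal_def successively_conv_nth len
    using assms by (auto simp: linked_pattern_def successively_conv_nth matches_strict_below[OF m])
qed

section \<open>Occurrences as placements of blocks\<close>

definition positions :: "nat list \<Rightarrow> nat list \<Rightarrow> nat list" where
  "positions ls as = concat (map2 (\<lambda>l a. [a..<a + l]) ls as)"

text \<open>The conditions of \<open>occurrences\<close> on the positions alone, without the
  relative order of the letters. The lower bound \<open>k\<close> serves the induction, where later
  positions must lie beyond the first block.\<close>

definition positions_ok :: "dashed \<Rightarrow> nat \<Rightarrow> nat \<Rightarrow> nat list \<Rightarrow> bool" where
  "positions_ok p k n is \<longleftrightarrow>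
     length is = length (concat p) \<and> sorted_wrt (<) is \<and> (\<forall>i\<in>set is. k \<le> i \<and> i < n) \<and>
     (\<forall>s. Suc s < length is \<and> \<not> dash_after p s \<longrightarrow> is ! Suc s = Suc (is ! s))"

text \<open>With 0-based positions the dash after \<open>t\<close> sits at
  \<open>length t - 1\<close>, and it exists only if a block follows. All other dashes are those of
  \<open>p\<close>, shifted.\<close>

lemma dash_after_Cons:
  assumes "t \<noteq> []"
  shows "dash_after (t # p) s \<longleftrightarrow>
    (p \<noteq> [] \<and> Suc s = length t) \<or> (length t \<le> s \<and> dash_after p (s - length t))"
    (is "?L \<longleftrightarrow> ?R")
proof
  assume ?L
  then obtain k where k: "k < Suc (length p)" "Suc s = length (concat (take k (t # p)))"
    by (auto simp: dash_after_def)
  then obtain k' where k': "k = Suc k'" by (cases k) auto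
  show ?R
  proof (cases k')
    case 0
    then show ?thesis using k k' by (cases p) auto
  next
    case (Suc m)
    show ?thesis
    proof (cases "length t \<le> s")
      case True
      then have "dash_after p (s - length t)"
        unfolding dash_after_def using k k' by (intro exI[of _ k']) auto
      with True show ?thesis by simp
    next
      case False
      have "length (concat (take k (t # p))) = length t + length (concat (take k' p))"
        by (simp add: k')
      then have "Suc s = length t" using False k(2) by linarith
      moreover have "p \<noteq> []" using k(1) k' by auto
      ultimately show ?thesis by simp
    qed
  qed
next
  assume ?R
  then show ?L
  proof
    assume "p \<noteq> [] \<and> Suc s = length t"
    then show ?L unfolding dash_after_def by (intro exI[of _ 1]) auto
  next
    assume "length t \<le> s \<and> dash_after p (s - length t)"
    then obtain k where "length t \<le> s" "k < length p" "Suc (s - length t) = length (concat (take k p))"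
      by (auto simp: dash_after_def)
    then show ?L unfolding dash_after_def by (intro exI[of _ "Suc k"]) auto
  qed
qed

lemma consecutive_eq_upt:
  assumes "is \<noteq> []" "\<And>s. Suc s < length is \<Longrightarrow> is ! Suc s = Suc (is ! s)"
  shows "is = [is ! 0..<is ! 0 + length is]"
proof (rule nth_equalityI)
  have "is ! s = is ! 0 + s" if "s < length is" for s
    using that assms(2) by (induction s) auto
  then show "is ! s = [is ! 0..<is ! 0 + length is] ! s" if "s < length is" for s
    using that by simp
qed simp

text \<open>There is no dash inside \<open>t\<close>, so its positions form an interval. Beyond it
  only monotonicity links the blocks, and this says that \<open>is2\<close> starts at
  \<open>a + length t\<close> or later.\<close>

lemma positions_ok_Cons:
  assumes "t \<noteq> []" "\<forall>t\<in>set p. t \<noteq> []" "length is1 = length t"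
  shows "positions_ok (t # p) k n (is1 @ is2) \<longleftrightarrow>
    (\<exists>a. is1 = [a..<a + length t] \<and> k \<le> a \<and> a + length t \<le> n \<and> positions_ok p (a + length t) n is2)"
    (is "?L \<longleftrightarrow> ?R")
proof
  assume L: ?L
  have step: "(is1 @ is2) ! Suc s = Suc ((is1 @ is2) ! s)"
    if "Suc s < length (is1 @ is2)" "\<not> dash_after (t # p) s" for s
    using L that unfolding positions_ok_def by blast
  have "is1 ! Suc s = Suc (is1 ! s)" if "Suc s < length is1" for s
    using step[of s] that assms by (auto simp: dash_after_Cons nth_append)
  moreover have "is1 \<noteq> []" using assms by auto
  ultimately obtain a where is1: "is1 = [a..<a + length t]"
    using consecutive_eq_upt[of is1] assms(3) by metis
  \<comment> \<open>The extreme positions carry the bounds: the first gives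
    \<open>k \<le> a\<close>, the last gives \<open>a + length t \<le> n\<close> and separates the
    block from \<open>is2\<close>.\<close>
  have last: "a \<in> set is1" "a + length t - 1 \<in> set is1" using assms(1) by (cases t; simp add: is1)+
  then have "k \<le> a" "a + length t - 1 < n" using L by (auto simp: positions_ok_def)
  moreover have "positions_ok p (a + length t) n is2"
    unfolding positions_ok_def
  proof (intro conjI allI impI ballI)
    show "length is2 = length (concat p)" "sorted_wrt (<) is2"
      using L assms(3) by (auto simp: positions_ok_def sorted_wrt_append)
    fix i assume i: "i \<in> set is2"
    then show "i < n" using L by (auto simp: positions_ok_def)
    have "a + length t - 1 < i"
      using L i last by (auto simp: positions_ok_def sorted_wrt_append)
    then show "a + length t \<le> i" by simp
  next
    fix s assume "Suc s < length is2 \<and> \<not> dash_after p s"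
    then show "is2 ! Suc s = Suc (is2 ! s)"
      using step[of "length t + s"] assms by (auto simp: dash_after_Cons nth_append)
  qed
  ultimately show ?R using is1 assms(1) by (cases t) auto
next
  assume ?R
  then obtain a where is1: "is1 = [a..<a + length t]" and a: "k \<le> a" "a + length t \<le> n"
    and ok: "positions_ok p (a + length t) n is2" by blast
  have "(is1 @ is2) ! Suc s = Suc ((is1 @ is2) ! s)"
    if s: "Suc s < length (is1 @ is2)" "\<not> dash_after (t # p) s" for s
  proof -
    consider "Suc s < length t" | "Suc s = length t" | "length t \<le> s" by linarith
    then show ?thesis
    proof cases
      case 1
      then show ?thesis by (simp add: is1 nth_append)
    next
      case 2
      \<comment> \<open>Here \<open>s\<close> is the last position of \<open>t\<close>. A dash
        follows it unless \<open>t\<close> is the only block, and then position \<open>Suc s\<close>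
        does not exist.\<close>
      then have "p = []" using s assms by (simp add: dash_after_Cons)
      then have "is2 = []" using ok by (simp add: positions_ok_def)
      then show ?thesis using s 2 assms(3) by simp
    next
      case 3
      then have "Suc (s - length t) < length is2 \<and> \<not> dash_after p (s - length t)"
        using s assms by (auto simp: dash_after_Cons)
      then have "is2 ! Suc (s - length t) = Suc (is2 ! (s - length t))"
        using ok by (simp add: positions_ok_def)
      then show ?thesis using 3 assms(3) by (simp add: nth_append Suc_diff_le)
    qed
  qed
  moreover have "sorted_wrt (<) (is1 @ is2)"
    using ok by (fastforce simp: is1 positions_ok_def sorted_wrt_append)
  ultimately show ?L
    using ok a by (auto simp: positions_ok_def is1)
qed

lemma positions_ok_iff:
  assumes "\<forall>t\<in>set p. t \<noteq> []"
  shows "positions_ok p k n is \<longleftrightarrow>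
    (\<exists>as. valid_starts (map length p) k n as \<and> is = positions (map length p) as)"
  using assms
proof (induction p arbitrary: k "is")
  case Nil
  show ?case by (auto simp: positions_ok_def positions_def)
next
  case (Cons t p)
  have t: "t \<noteq> []" "\<forall>t\<in>set p. t \<noteq> []" using Cons.prems by auto
  have pos: "positions (l # ls) (a # as) = [a..<a + l] @ positions ls as" for l ls a as
    by (simp add: positions_def)
  show ?case
  proof
    assume ok: "positions_ok (t # p) k n is"
    then have "length is = length t + length (concat p)" by (simp add: positions_ok_def)
    then obtain is1 is2 where "is": "is = is1 @ is2" "length is1 = length t"
      by (metis append_take_drop_id length_take le_add1 min_absorb2)
    then obtain a where a: "is1 = [a..<a + length t]" "k \<le> a" "a + length t \<le> n"
      "positions_ok p (a + length t) n is2"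
      using ok positions_ok_Cons[OF t] by blast
    then obtain as where "valid_starts (map length p) (a + length t) n as" "is2 = positions (map length p) as"
      using Cons.IH[OF t(2)] by blast
    then show "\<exists>as. valid_starts (map length (t # p)) k n as \<and> is = positions (map length (t # p)) as"
      using a "is" by (intro exI[of _ "a # as"]) (simp add: pos)
  next
    assume "\<exists>as. valid_starts (map length (t # p)) k n as \<and> is = positions (map length (t # p)) as"
    then obtain as where as: "valid_starts (map length (t # p)) k n as"
      "is = positions (map length (t # p)) as" by blast
    then obtain a as' where "as = a # as'" by (cases as) auto
    with as show "positions_ok (t # p) k n is"
      using positions_ok_Cons[OF t, of "[a..<a + length t]"] Cons.IH[OF t(2)] by (auto simp: pos)
  qed
qed

lemma inj_on_positions:
  assumes "\<forall>l\<in>set ls. 0 < l"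
  shows "inj_on (positions ls) {as. valid_starts ls k n as}"
proof (rule inj_onI, clarify)
  fix as bs assume "valid_starts ls k n as" "valid_starts ls k n bs" "positions ls as = positions ls bs"
  with assms show "as = bs"
  proof (induction ls arbitrary: k as bs)
    case (Cons l ls)
    obtain a as' b bs' where [simp]: "as = a # as'" "bs = b # bs'"
      using Cons.prems by (cases as; cases bs) auto
    have eq: "[a..<a + l] @ positions ls as' = [b..<b + l] @ positions ls bs'"
      using Cons.prems by (simp add: positions_def)
    moreover have "length [a..<a + l] = length [b..<b + l]" by simp
    ultimately have "[a..<a + l] = [b..<b + l]" "positions ls as' = positions ls bs'"
      unfolding append_eq_append_conv by auto
    moreover have "0 < l" using Cons.prems by simp
    ultimately have "a = b" by (metis less_add_same_cancel1 upt_conv_Cons list.inject)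
    then show ?case using Cons.IH[of "a + l" as' bs'] Cons.prems \<open>positions ls as' = positions ls bs'\<close> by simp
  qed simp
qed

lemma valid_starts_blocks_at:
  assumes "valid_starts ls k (length w) as"
  shows "map length (blocks_at w ls as) = ls"
    and "concat (blocks_at w ls as) = map ((!) w) (positions ls as)"
    and "length (positions ls as) = sum_list ls"
proof -
  have nth: "take l (drop a w) = map ((!) w) [a..<a + l]" if "a + l \<le> length w" for a l
    using that by (intro nth_equalityI) auto
  have "map length (blocks_at w ls as) = ls \<and> concat (blocks_at w ls as) = map ((!) w) (positions ls as)
      \<and> length (positions ls as) = sum_list ls"
    using assms
    by (induction ls k "length w" as rule: valid_starts.induct)
      (auto simp: blocks_at_def positions_def nth)
  then show "map length (blocks_at w ls as) = ls"
    "concat (blocks_at w ls as) = map ((!) w) (positions ls as)"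
    "length (positions ls as) = sum_list ls" by blast+
qed

lemma occ_eq_card_placements:
  assumes "\<forall>t\<in>set p. t \<noteq> []"
  shows "occ p w = card (placements (matches p) (map length p) 0 w)"
proof -
  let ?ls = "map length p"
  let ?iso = "\<lambda>is. \<forall>s<length is. \<forall>t<length is. w ! (is ! s) > w ! (is ! t) \<longleftrightarrow> concat p ! s > concat p ! t"
  have m: "matches p (blocks_at w ?ls as) \<longleftrightarrow> ?iso (positions ?ls as)" if "valid_starts ?ls 0 (length w) as" for as
  proof -
    let ?is = "positions ?ls as"
    have "length ?is = length (concat p)"
      using valid_starts_blocks_at(3)[OF that] by (simp add: length_concat)
    \<comment> \<open>Indexing the pairs turns the condition of \<open>matches\<close> on pairs into
      the condition of \<open>occurrences\<close> on indices.\<close>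
    then have "zip (map ((!) w) ?is) (concat p) = map (\<lambda>s. (w ! (?is ! s), concat p ! s)) [0..<length ?is]"
      by (intro nth_equalityI) simp_all
    then show ?thesis
      unfolding matches_def valid_starts_blocks_at(1,2)[OF that] by (simp, simp add: Ball_def)
  qed
  have "occurrences p w = {is. positions_ok p 0 (length w) is \<and> ?iso is}"
    unfolding occurrences_def positions_ok_def
    by (rule Collect_cong) (simp only: le0 simp_thms, blast)
  also have "\<dots> = positions ?ls ` placements (matches p) ?ls 0 w"
    unfolding positions_ok_iff[OF assms] placements_def using m by blast
  finally have "occ p w = card (positions ?ls ` placements (matches p) ?ls 0 w)"
    by (simp add: occ_def)
  also have "\<dots> = card (placements (matches p) ?ls 0 w)"
    by (intro card_image inj_on_subset[OF inj_on_positions[of _ 0 "length w"]])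
      (use assms in \<open>auto simp: placements_def\<close>)
  finally show ?thesis .
qed

subsection \<open>Commutation and reversal\<close>

text \<open>The occurrence count as a function of an arbitrary list of blocks. This generality
  matters because swapping or reversing runs need not yield a \<open>run_list\<close>.\<close>

definition run_occ :: "dashed \<Rightarrow> nat list list \<Rightarrow> nat" where
  "run_occ p Ds = (\<Sum>Es\<leftarrow>subseqs Ds. card (selections (matches p) (map length p) Es))"

lemma occ_concat:
  assumes "linked_pattern p" "run_list Ds"
  shows "occ p (concat Ds) = run_occ p Ds"
proof -
  have "\<forall>t\<in>set p. t \<noteq> []" using assms by (auto simp: linked_pattern_def)
  then have "occ p (concat Ds) = card (placements (matches p) (map length p) 0 (concat Ds))"
    by (rule occ_eq_card_placements)
  also have "\<dots> = run_occ p Ds"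
    unfolding run_occ_def using assms
    by (intro card_placements_concat respects_runs_matches) (auto simp: linked_pattern_def)
  finally show ?thesis .
qed

lemma sum_subseqs_append:
  fixes f :: "'a list \<Rightarrow> nat"
  shows "(\<Sum>zs\<leftarrow>subseqs (xs @ ys). f zs) = (\<Sum>as\<leftarrow>subseqs xs. \<Sum>bs\<leftarrow>subseqs ys. f (as @ bs))"
  by (induction xs arbitrary: f) (simp_all add: Let_def comp_def)

lemma sum_subseqs_rev:
  fixes f :: "'a list \<Rightarrow> nat"
  shows "(\<Sum>zs\<leftarrow>subseqs (rev xs). f zs) = (\<Sum>zs\<leftarrow>subseqs xs. f (rev zs))"
  by (induction xs arbitrary: f)
    (simp_all add: Let_def comp_def sum_subseqs_append sum_list_addf)

lemma selections_matches_rev: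
  "selections (matches (rev p)) (map length (rev p)) (rev Es) = rev ` selections (matches p) (map length p) Es"
proof -
  have *: "rev Fs \<in> selections (matches (rev p)) (map length (rev p)) (rev Es) \<longleftrightarrow>
      Fs \<in> selections (matches p) (map length p) Es" for Fs
    by (simp add: selections_def matches_rev rev_map[symmetric])
  show ?thesis
  proof (intro equalityI subsetI)
    fix Fs assume "Fs \<in> selections (matches (rev p)) (map length (rev p)) (rev Es)"
    then have "rev Fs \<in> selections (matches p) (map length p) Es" using *[of "rev Fs"] by simp
    then show "Fs \<in> rev ` selections (matches p) (map length p) Es" by (force simp: image_iff)
  qed (use * in blast)
qed

text \<open>Reversing the runs reverses every subsequence and every selection from it, while
  \<open>R p\<close> reverses the blocks of the pattern, so the selections correspond.\<close>

lemma run_occ_R_rev: "run_occ (R p) (rev Ds) = run_occ p Ds"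
  by (simp add: run_occ_def R_def sum_subseqs_rev selections_matches_rev card_image)

text \<open>Nonempty factors of \<open>D\<close> and \<open>E\<close> inherit their strict
  comparability, and a match would transfer it to two neighbouring blocks of \<open>p\<close>, which
  are not strictly comparable.\<close>

lemma selections_strict_below:
  assumes "linked_pattern p" "strict_below D E \<or> strict_below E D"
  shows "selections (matches p) (map length p) (As @ D # E # Bs) = {}"
proof (rule equals0I)
  fix Fs assume "Fs \<in> selections (matches p) (map length p) (As @ D # E # Bs)"
  then have m: "matches p Fs" and l: "list_all2 sublist Fs (As @ D # E # Bs)"
    by (auto simp: selections_def)
  have len: "length Fs = length p"
    using m unfolding matches_def by (intro map_eq_imp_length_eq) blast
  let ?i = "length As"
  have i: "Suc ?i < length p" using list_all2_lengthD[OF l] len by simp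
  have "sublist (Fs ! ?i) D" "sublist (Fs ! Suc ?i) E"
    using list_all2_nthD[OF l, of ?i] list_all2_nthD[OF l, of "Suc ?i"] i len
    by (auto simp: nth_append)
  then have sub: "set (Fs ! ?i) \<subseteq> set D" "set (Fs ! Suc ?i) \<subseteq> set E"
    by (auto dest: set_mono_sublist)
  have "p ! ?i \<noteq> []" "p ! Suc ?i \<noteq> []"
    using assms(1) i by (auto simp: linked_pattern_def)
  then have "Fs ! ?i \<noteq> []" "Fs ! Suc ?i \<noteq> []"
    using matches_length_nth[OF m, of ?i] matches_length_nth[OF m, of "Suc ?i"] i by auto
  with sub assms(2) have "strict_below (Fs ! ?i) (Fs ! Suc ?i) \<or> strict_below (Fs ! Suc ?i) (Fs ! ?i)"
    unfolding strict_below_def below_def by blast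
  moreover have "\<not> strict_below (p ! ?i) (p ! Suc ?i)" "\<not> strict_below (p ! Suc ?i) (p ! ?i)"
    using assms(1) i by (auto simp: linked_pattern_def successively_conv_nth)
  ultimately show False
    using i by (simp add: matches_strict_below[OF m])
qed

text \<open>Subsequences using at most one of \<open>D\<close> and \<open>E\<close> at these places
  are the same before and after the swap; those using both contribute nothing in either
  order.\<close>

lemma comm_invariant_run_occ:
  assumes "linked_pattern p"
  shows "comm_invariant strict_below (run_occ p)"
  unfolding comm_invariant_def
proof (intro allI impI)
  fix As D E Bs assume "strict_below D E"
  then show "run_occ p (As @ D # E # Bs) = run_occ p (As @ E # D # Bs)"
    using selections_strict_below[OF assms]
    by (simp add: run_occ_def sum_subseqs_append Let_def comp_def sum_list_addf)
qed

theorem theorem1p8: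
  fixes M :: "nat list multiset" and ps :: "dashed list" and ks :: "nat list"
  assumes "\<forall>D\<in>#M. D \<in> decreasing_seqs"
    and "\<forall>p\<in>set ps. dashed_pattern p \<and> piecewise_decreasing p \<and> connected_pattern p"
    and "length ks = length ps"
  shows "card {w \<in> words_with_runs M. pattern_statistic ps w = ks}
       = card {w \<in> words_with_runs M. pattern_statistic (map R ps) w = ks}"
proof -
  let ?N = "{Ds. run_list Ds \<and> mset Ds = M}"
  \<comment> \<open>The reversed list of runs is in general not a run list; normalising selects the
    run list in its commutation class.\<close>
  let ?\<phi> = "\<lambda>Ds. normal_form strict_below (rev Ds)"
  let ?A = "\<lambda>qs. {Ds \<in> ?N. pattern_statistic qs (concat Ds) = ks}"
  note order = transp_strict_below asymp_strict_below
  have linked: "linked_pattern p" if "p \<in> set ps" for p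
    using that assms(2) by (blast intro: linked_patternI)
  have \<phi>_N: "?\<phi> Ds \<in> ?N" if "Ds \<in> ?N" for Ds
  proof -
    \<comment> \<open>Normalising only permutes, so the entries remain nonempty and decreasing and
      the multiset remains \<open>M\<close>.\<close>
    have ms: "mset (?\<phi> Ds) = mset Ds"
      by (simp add: comm_invariant_apply_normal_form[OF comm_invariant_mset])
    then have "set (?\<phi> Ds) = set Ds" by (rule mset_eq_setD)
    then show ?thesis
      using that ms normal_normal_form[OF order(2)] by (simp add: run_list_def)
  qed
  have \<phi>_\<phi>: "?\<phi> (?\<phi> Ds) = Ds" if "Ds \<in> ?N" for Ds
    using that by (intro normal_form_rev_involution order) (simp add: run_list_def)
  have stat: "pattern_statistic (map R ps) (concat (?\<phi> Ds)) = pattern_statistic ps (concat Ds)"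
    if "Ds \<in> ?N" for Ds
  proof -
    have "occ (R p) (concat (?\<phi> Ds)) = occ p (concat Ds)" if p: "p \<in> set ps" for p
    proof -
      have R: "linked_pattern (R p)" using linked[OF p] by (simp add: linked_pattern_R)
      have "run_list (?\<phi> Ds)" using \<phi>_N[OF \<open>Ds \<in> ?N\<close>] by simp
      then have "occ (R p) (concat (?\<phi> Ds)) = run_occ (R p) (?\<phi> Ds)"
        using R by (intro occ_concat)
      \<comment> \<open>The normal form is dropped at the level of run lists, since
        \<open>rev Ds\<close> need not be the run decomposition of its concatenation.\<close>
      also have "\<dots> = run_occ (R p) (rev Ds)"
        by (rule comm_invariant_apply_normal_form[OF comm_invariant_run_occ[OF R]])
      also have "\<dots> = occ p (concat Ds)"
        using \<open>Ds \<in> ?N\<close> linked[OF p] by (simp add: run_occ_R_rev occ_concat)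
      finally show ?thesis .
    qed
    then show ?thesis by (simp add: pattern_statistic_def)
  qed
  have "bij_betw ?\<phi> (?A ps) (?A (map R ps))"
  proof (rule bij_betw_byWitness[where f' = ?\<phi>])
    show "?\<phi> ` ?A ps \<subseteq> ?A (map R ps)"
      using \<phi>_N stat by auto
    \<comment> \<open>Applying \<open>stat\<close> to \<open>?\<phi> Ds\<close> and cancelling
      \<open>?\<phi>\<close> twice gives the transfer in the opposite direction.\<close>
    have "?\<phi> Ds \<in> ?A ps" if "Ds \<in> ?A (map R ps)" for Ds
      using that \<phi>_N[of Ds] \<phi>_\<phi>[of Ds] stat[of "?\<phi> Ds"] by auto
    then show "?\<phi> ` ?A (map R ps) \<subseteq> ?A ps" by blast
  qed (use \<phi>_\<phi> in auto)
  then have "card (?A ps) = card (?A (map R ps))" by (rule bij_betw_same_card)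
  \<comment> \<open>The equality for run lists is carried over to words by the bijection
    \<open>concat\<close>, for both families of patterns at once.\<close>
  moreover have "card (?A qs) = card {w \<in> words_with_runs M. pattern_statistic qs w = ks}" for qs
  proof -
    note bij = bij_betw_concat_words_with_runs[OF assms(1)]
    have "words_with_runs M = concat ` ?N"
      using bij by (simp add: bij_betw_def)
    then have "concat ` ?A qs = {w \<in> words_with_runs M. pattern_statistic qs w = ks}"
      by auto
    moreover have "inj_on concat (?A qs)"
      by (rule inj_on_subset[OF bij_betw_imp_inj_on[OF bij]]) blast
    ultimately show ?thesis using card_image[of concat "?A qs"] by simp
  qed
  ultimately show ?thesis by simp
qed

end
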